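(* For all $n\ge 1$, $\dim(\widetilde{\mathcal{BG}}(n))=f_n^{\mathcal{BT}}$, and the map $$\Psi:\widetilde{\mathcal{BG}}(n)\to \mathrm{Vect}(\text{forests in }\mathbb{F}\text{ of degree }n)\subseteq\mathcal{M},\qquad p\mapsto p.(\bullet,\dots,\bullet)$$ is bijective.
   Context: $\mathbb{K}$ is a commutative field of any characteristic. A bigraft algebra ($\mathcal{BG}$-algebra) is a $\mathbb{K}$-vector space $A$ with three linear maps $\ast,\succ,\prec:A\otimes A\to A$ such that for all $x,y,z\in A$: $(x\ast y)\ast z=x\ast(y\ast z)$, $(x\ast y)\succ z=x\succ(y\succ z)$, $(x\succ y)\ast z=x\succ(y\ast z)$, $(x\prec y)\prec z=x\prec(y\ast z)$, $(x\ast y)\prec z=x\ast(y\prec z)$, $(x\succ y)\prec z=x\succ(y\prec z)$ (no unit assumed). $\mathcal{BG}$ is the corresponding (regular, binary quadratic) operad, and $\widetilde{\mathcal{BG}}$ the nonsymmetric operad with the same generators (three binary operations) and relations, so that $\mathcal{BG}$ is its symmetrization. Elements $p\in\widetilde{\mathcal{BG}}(n)$ act on $\mathcal{BG}$-algebras as $n$-ary operations, written $p.(a_1,\dots,a_n)$. We consider planar rooted forests (finite ordered sequences of planar rooted trees) whose edges are decorated by $l$ or $r$; the degree of a forest is its number of vertices, $1$ is the empty forest and $\bullet$ the tree with one vertex. For two such forests $F,G$, $B(F\otimes G)$ is the tree obtained by grafting the roots of the trees of $F$ followed by those of $G$ (in this left-to-right order) on a common new root, the edges from the new root to the roots of $F$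 being decorated by $l$ and those to the roots of $G$ by $r$. Let $\mathbb{T}$ be the set consisting of $1$ and of the trees obtained inductively as $B(F_1\cdots F_p\otimes G_1\cdots G_q)$, $p,q\ge 0$, with all $F_i,G_j$ nonempty trees already in $\mathbb{T}$; $\mathbb{F}$ is the set of forests all of whose trees are in $\mathbb{T}$ (including $1$). $f_n^{\mathcal{BT}}$ is the number of forests of degree $n$ in $\mathbb{F}$. $\mathcal{M}$ is the vector space with basis $\mathbb{F}\setminus\{1\}$; it is a $\mathcal{BG}$-algebra for concatenation and the operations defined, for $F=F_1\cdots F_n$, $G=G_1\cdots G_k$ in $\mathbb{F}\setminus\{1\}$ (the $F_i,G_j$ nonempty trees) with $F_1=B(F_1^1\otimes F_1^2)$, $G_k=B(G_k^1\otimes G_k^2)$, by $G\succ F=B(GF_1^1\otimes F_1^2)F_2\cdots F_n$ and $G\prec F=G_1\cdots G_{k-1}B(G_k^1\otimes G_k^2F)$. *)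

theory Defs
  imports Complex_Main "HOL-Library.Poly_Mapping"
begin

section \<open>Vector spaces with a given basis\<close>

text \<open>The vector space with basis \<^typ>\<open>'a\<close> over a field \<open>'k\<close> is the type
  \<open>'a \<Rightarrow>\<^sub>0 'k\<close> of finitely supported functions.\<close>

definition pm_scale :: "'k::field \<Rightarrow> ('a \<Rightarrow>\<^sub>0 'k) \<Rightarrow> ('a \<Rightarrow>\<^sub>0 'k)" where
  "pm_scale c p = Poly_Mapping.map ((*) c) p"

lemma lookup_pm_scale [simp]: "Poly_Mapping.lookup (pm_scale c p) x = c * Poly_Mapping.lookup p x"
  by (simp add: pm_scale_def Poly_Mapping.map.rep_eq when_def)

global_interpretation pm: vector_space "pm_scale :: 'k::field \<Rightarrow> ('a \<Rightarrow>\<^sub>0 'k) \<Rightarrow> _"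
  by unfold_locales (auto intro!: poly_mapping_eqI simp: lookup_add algebra_simps)

definition basis_vec :: "'a \<Rightarrow> ('a \<Rightarrow>\<^sub>0 'k::field)" where
  "basis_vec x = Poly_Mapping.single x 1"

definition lin_ext :: "('k::field \<Rightarrow> 'b \<Rightarrow> 'b) \<Rightarrow> ('a \<Rightarrow> 'b::ab_group_add) \<Rightarrow> ('a \<Rightarrow>\<^sub>0 'k) \<Rightarrow> 'b" where
  "lin_ext scale f p = (\<Sum>x\<in>Poly_Mapping.keys p. scale (Poly_Mapping.lookup p x) (f x))"

definition bilin_ext ::
    "('a \<Rightarrow> 'b \<Rightarrow> 'c) \<Rightarrow> ('a \<Rightarrow>\<^sub>0 'k::field) \<Rightarrow> ('b \<Rightarrow>\<^sub>0 'k) \<Rightarrow> ('c \<Rightarrow>\<^sub>0 'k)" where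
  "bilin_ext f p q =
     lin_ext pm_scale (\<lambda>x. lin_ext pm_scale (\<lambda>y. basis_vec (f x y)) q) p"

lemma (in vector_space) lin_ext_superset:
  assumes "finite A" "Poly_Mapping.keys p \<subseteq> A"
  shows "lin_ext scale f p = (\<Sum>x\<in>A. scale (Poly_Mapping.lookup p x) (f x))"
  unfolding lin_ext_def using assms
  by (intro sum.mono_neutral_left) (auto simp: in_keys_iff)

lemma (in vector_space) lin_ext_add:
  "lin_ext scale f (p + q) = lin_ext scale f p + lin_ext scale f q"
proof -
  let ?A = "Poly_Mapping.keys p \<union> Poly_Mapping.keys q"
  have "Poly_Mapping.keys (p + q) \<subseteq> ?A" by (rule Poly_Mapping.keys_add)
  then show ?thesis
    by (simp add: lin_ext_superset[of ?A] lookup_add scale_left_distrib sum.distrib)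
qed

lemma (in vector_space) lin_ext_scale:
  "lin_ext scale f (pm_scale c p) = scale c (lin_ext scale f p)"
proof -
  have "Poly_Mapping.keys (pm_scale c p) \<subseteq> Poly_Mapping.keys p" by (auto simp: in_keys_iff)
  then show ?thesis
    by (simp add: lin_ext_superset[of "Poly_Mapping.keys p"] scale_sum_right)
qed

lemma (in vector_space) linear_lin_ext: "Vector_Spaces.linear pm_scale scale (lin_ext scale f)"
  by (simp add: Vector_Spaces.linear_iff lin_ext_add lin_ext_scale vector_space_axioms pm.vector_space_axioms)

lemma (in vector_space) lin_ext_basis_vec [simp]: "lin_ext scale f (basis_vec x) = f x"
  by (simp add: lin_ext_def basis_vec_def)

lemma lin_ext_unique:
  fixes g :: "('a \<Rightarrow>\<^sub>0 'k::field) \<Rightarrow> 'b::ab_group_add"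
  assumes "Vector_Spaces.linear pm_scale scale g"
  shows "g = lin_ext scale (\<lambda>x. g (basis_vec x))"
proof
  fix p :: "'a \<Rightarrow>\<^sub>0 'k"
  interpret Vector_Spaces.linear pm_scale scale g by fact
  have "p = lin_ext pm_scale basis_vec p"
    by (rule poly_mapping_eqI)
      (auto simp: lin_ext_def lookup_sum basis_vec_def lookup_single when_def in_keys_iff
        if_distrib[of "(*) _"] sum.delta cong: if_cong)
  then have "g p = g (lin_ext pm_scale basis_vec p)" by simp
  then show "g p = lin_ext scale (\<lambda>x. g (basis_vec x)) p"
    by (simp add: lin_ext_def sum scale)
qed

lemma linear_eq_on_basis:
  assumes "Vector_Spaces.linear pm_scale scale g" "Vector_Spaces.linear pm_scale scale h"
    and "\<And>x. x \<in> Poly_Mapping.keys p \<Longrightarrow> g (basis_vec x) = h (basis_vec x)"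
  shows "g p = h p"
  using assms(3)
  by (subst lin_ext_unique[OF assms(1)], subst lin_ext_unique[OF assms(2)]) (simp add: lin_ext_def)

lemma linear_bilin_ext_left: "Vector_Spaces.linear pm_scale pm_scale (\<lambda>p. bilin_ext f p q)"
  unfolding bilin_ext_def by (rule pm.linear_lin_ext)

lemma linear_bilin_ext_right: "Vector_Spaces.linear pm_scale pm_scale (bilin_ext f p)"
  unfolding Vector_Spaces.linear_iff bilin_ext_def
  by (auto simp: pm.vector_space_axioms pm.lin_ext_add pm.lin_ext_scale)
    (auto simp: lin_ext_def pm.scale_right_distrib sum.distrib pm.scale_sum_right mult.left_commute)

lemma bilin_ext_basis_vec [simp]: "bilin_ext f (basis_vec x) (basis_vec y) = basis_vec (f x y)"
  by (simp add: bilin_ext_def)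

lemma keys_bilin_ext: "Poly_Mapping.keys (bilin_ext f p q) \<subseteq> (\<lambda>(x, y). f x y) ` (Poly_Mapping.keys p \<times> Poly_Mapping.keys q)"
proof
  fix z assume "z \<in> Poly_Mapping.keys (bilin_ext f p q)"
  then have "(\<Sum>x\<in>Poly_Mapping.keys p. Poly_Mapping.lookup p x * (\<Sum>y\<in>Poly_Mapping.keys q. Poly_Mapping.lookup q y * Poly_Mapping.lookup (basis_vec (f x y)) z)) \<noteq> 0"
    by (simp add: in_keys_iff bilin_ext_def lin_ext_def lookup_sum)
  then obtain x where x: "x \<in> Poly_Mapping.keys p"
      "(\<Sum>y\<in>Poly_Mapping.keys q. Poly_Mapping.lookup q y * Poly_Mapping.lookup (basis_vec (f x y)) z) \<noteq> 0"
    by (metis (no_types, lifting) mult_zero_right sum.neutral)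
  then obtain y where "y \<in> Poly_Mapping.keys q" "Poly_Mapping.lookup q y * Poly_Mapping.lookup (basis_vec (f x y)) z \<noteq> 0"
    by (metis (no_types, lifting) sum.neutral)
  with x show "z \<in> (\<lambda>(x, y). f x y) ` (Poly_Mapping.keys p \<times> Poly_Mapping.keys q)"
    by (force simp: basis_vec_def lookup_single when_def split: if_splits)
qed


lemma bilin_ext_assoc:
  fixes p :: "'a \<Rightarrow>\<^sub>0 'k::field" and q :: "'b \<Rightarrow>\<^sub>0 'k" and r :: "'c \<Rightarrow>\<^sub>0 'k"
  assumes "\<And>x y z. f1 (f2 x y) z = g1 x (g2 y z)"
  shows "bilin_ext f1 (bilin_ext f2 p q) r = bilin_ext g1 p (bilin_ext g2 q r)"
proof -
  note comp = Vector_Spaces.linear_compose[unfolded o_def]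
  note lin = linear_bilin_ext_left linear_bilin_ext_right
  have "bilin_ext f1 (bilin_ext f2 (basis_vec x) (basis_vec y)) r =
      bilin_ext g1 (basis_vec x) (bilin_ext g2 (basis_vec y) r)" for x y
    by (rule linear_eq_on_basis[OF linear_bilin_ext_right
          comp[OF linear_bilin_ext_right linear_bilin_ext_right]]) (simp add: assms)
  then have "bilin_ext f1 (bilin_ext f2 (basis_vec x) q) r =
      bilin_ext g1 (basis_vec x) (bilin_ext g2 q r)" for x
    by (rule linear_eq_on_basis[OF comp[OF linear_bilin_ext_right linear_bilin_ext_left]
          comp[OF linear_bilin_ext_left linear_bilin_ext_right]])
  then show ?thesis
    by (rule linear_eq_on_basis[OF comp[OF linear_bilin_ext_left linear_bilin_ext_left]
          linear_bilin_ext_left])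
qed


section \<open>The nonsymmetric operad of bigraft algebras\<close>

text \<open>The free nonsymmetric operad on three binary generators has in arity \<open>n\<close> the basis of
  planar binary trees with \<open>n\<close> leaves and internal vertices labelled by generators.\<close>

datatype bg_gen = Ast | Succ | Prec

datatype pbt = Leaf | Node bg_gen pbt pbt

primrec leaves :: "pbt \<Rightarrow> nat" where
  "leaves Leaf = 1"
| "leaves (Node g s t) = leaves s + leaves t"

text \<open>\<open>graft i s t\<close> replaces the leaf number \<open>i\<close> of \<open>s\<close>, counted from 0, by \<open>t\<close>; it is only meant
  for \<open>i < leaves s\<close>.\<close>

primrec graft :: "nat \<Rightarrow> pbt \<Rightarrow> pbt \<Rightarrow> pbt" where
  "graft i Leaf t = t"
| "graft i (Node g a b) t =
     (if i < leaves a then Node g (graft i a t) b else Node g a (graft (i - leaves a) b t))"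

definition free_op :: "nat \<Rightarrow> (pbt \<Rightarrow>\<^sub>0 'k::field) set" where
  "free_op n = {p. \<forall>t\<in>Poly_Mapping.keys p. leaves t = n}"

definition pcomp :: "nat \<Rightarrow> (pbt \<Rightarrow>\<^sub>0 'k::field) \<Rightarrow> (pbt \<Rightarrow>\<^sub>0 'k) \<Rightarrow> (pbt \<Rightarrow>\<^sub>0 'k)" where
  "pcomp i = bilin_ext (graft i)"

text \<open>\<open>lcomp a b\<close> is the operation \<open>(x b y) a z\<close>, and \<open>rcomp a b\<close> is \<open>x a (y b z)\<close>.\<close>

definition lcomp :: "bg_gen \<Rightarrow> bg_gen \<Rightarrow> (pbt \<Rightarrow>\<^sub>0 'k::field)" where
  "lcomp a b = basis_vec (Node a (Node b Leaf Leaf) Leaf)"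

definition rcomp :: "bg_gen \<Rightarrow> bg_gen \<Rightarrow> (pbt \<Rightarrow>\<^sub>0 'k::field)" where
  "rcomp a b = basis_vec (Node a Leaf (Node b Leaf Leaf))"

definition bg_relators :: "(pbt \<Rightarrow>\<^sub>0 'k::field) set" where
  "bg_relators =
    {lcomp Ast Ast - rcomp Ast Ast,
     lcomp Succ Ast - rcomp Succ Succ,
     lcomp Ast Succ - rcomp Succ Ast,
     lcomp Prec Prec - rcomp Prec Ast,
     lcomp Prec Ast - rcomp Ast Prec,
     lcomp Prec Succ - rcomp Succ Prec}"

text \<open>The operadic ideal generated by the relators, by arity.\<close>

inductive bg_ideal :: "nat \<Rightarrow> (pbt \<Rightarrow>\<^sub>0 'k::field) \<Rightarrow> bool" where
  relator: "r \<in> bg_relators \<Longrightarrow> bg_ideal 3 r"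
| zero: "bg_ideal n 0"
| add: "bg_ideal n p \<Longrightarrow> bg_ideal n q \<Longrightarrow> bg_ideal n (p + q)"
| scale: "bg_ideal n p \<Longrightarrow> bg_ideal n (pm_scale c p)"
| comp_left: "bg_ideal n p \<Longrightarrow> q \<in> free_op m \<Longrightarrow> i < n \<Longrightarrow> bg_ideal (n + m - 1) (pcomp i p q)"
| comp_right: "q \<in> free_op n \<Longrightarrow> bg_ideal m p \<Longrightarrow> i < n \<Longrightarrow> bg_ideal (n + m - 1) (pcomp i q p)"

lemma leaves_pos [simp]: "leaves t > 0"
  by (induction t) auto

lemma leaves_graft: "i < leaves s \<Longrightarrow> leaves (graft i s t) = leaves s + leaves t - 1"
proof (induction s arbitrary: i)
  case (Node g a b)
  then show ?case
    using leaves_pos[of a] leaves_pos[of b] leaves_pos[of t] by (auto simp del: leaves_pos)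
qed simp

lemma subspace_free_op: "pm.subspace (free_op n)"
  unfolding pm.subspace_def free_op_def
  by (auto simp: in_keys_iff lookup_add)

lemma basis_vec_free_op: "basis_vec t \<in> free_op n \<longleftrightarrow> leaves t = n"
  by (simp add: free_op_def basis_vec_def)

lemma pcomp_free_op:
  assumes "p \<in> free_op n" "q \<in> free_op m" "i < n"
  shows "pcomp i p q \<in> free_op (n + m - 1)"
proof -
  have "\<forall>t \<in> (\<lambda>(x, y). graft i x y) ` (Poly_Mapping.keys p \<times> Poly_Mapping.keys q). leaves t = n + m - 1"
    using assms by (auto simp: free_op_def leaves_graft)
  then show ?thesis
    using keys_bilin_ext[of "graft i" p q] by (auto simp: free_op_def pcomp_def)
qed

lemma bg_ideal_free_op: "bg_ideal n p \<Longrightarrow> p \<in> free_op n"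
proof (induction rule: bg_ideal.induct)
  case (relator r)
  have "lcomp a b - rcomp c d \<in> (free_op 3 :: (pbt \<Rightarrow>\<^sub>0 'a) set)" for a b c d
    by (intro pm.subspace_diff[OF subspace_free_op])
      (simp_all add: lcomp_def rcomp_def basis_vec_free_op)
  with relator show ?case by (auto simp: bg_relators_def)
qed (auto intro: pcomp_free_op[unfolded One_nat_def] pm.subspace_0[OF subspace_free_op] pm.subspace_add[OF subspace_free_op]
    pm.subspace_scale[OF subspace_free_op])

text \<open>All arities are collected in one type: \<open>'k bg\<close> is the direct sum over \<open>n\<close> of the quotients
  of \<^term>\<open>free_op n\<close> by the ideal in arity \<open>n\<close>, and \<open>bg_component n\<close> is the summand of arity
  \<open>n\<close>; see \<open>abs_bg_eq_iff\<close> below.\<close>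

definition bg_null :: "(pbt \<Rightarrow>\<^sub>0 'k::field) set" where
  "bg_null = pm.span {p. \<exists>n. bg_ideal n p}"

definition bg_rel :: "(pbt \<Rightarrow>\<^sub>0 'k::field) \<Rightarrow> (pbt \<Rightarrow>\<^sub>0 'k) \<Rightarrow> bool" where
  "bg_rel p q \<longleftrightarrow> p - q \<in> bg_null"

lemma subspace_bg_null: "pm.subspace bg_null"
  by (simp add: bg_null_def)

lemmas bg_null_intros =
  pm.subspace_0[OF subspace_bg_null] pm.subspace_add[OF subspace_bg_null]
  pm.subspace_neg[OF subspace_bg_null] pm.subspace_scale[OF subspace_bg_null]

lemma equivp_bg_rel: "equivp bg_rel"
proof (rule equivpI)
  show "reflp bg_rel"
    by (simp add: reflp_def bg_rel_def bg_null_intros)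
  show "symp bg_rel"
    unfolding symp_def bg_rel_def by (metis bg_null_intros(3) minus_diff_eq)
  show "transp bg_rel"
    unfolding transp_def bg_rel_def by (metis bg_null_intros(2) diff_add_cancel add_diff_eq)
qed

quotient_type (overloaded) 'k bg = "pbt \<Rightarrow>\<^sub>0 ('k::field)" / bg_rel
  by (rule equivp_bg_rel)

instantiation bg :: (field) ab_group_add
begin

lift_definition zero_bg :: "'a bg" is 0 .

lift_definition plus_bg :: "'a bg \<Rightarrow> 'a bg \<Rightarrow> 'a bg" is "(+)"
  unfolding bg_rel_def by (metis bg_null_intros(2) add_diff_add)

lift_definition uminus_bg :: "'a bg \<Rightarrow> 'a bg" is uminus
  unfolding bg_rel_def by (metis bg_null_intros(3) minus_diff_minus)

lift_definition minus_bg :: "'a bg \<Rightarrow> 'a bg \<Rightarrow> 'a bg" is "(-)"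
  unfolding bg_rel_def
proof -
  fix p p' q q' :: "pbt \<Rightarrow>\<^sub>0 'a"
  assume "p - p' \<in> bg_null" "q - q' \<in> bg_null"
  then have "(p - p') - (q - q') \<in> bg_null"
    by (rule pm.subspace_diff[OF subspace_bg_null])
  then show "p - q - (p' - q') \<in> bg_null" by (simp add: algebra_simps)
qed

instance
  by standard (transfer, simp add: bg_rel_def bg_null_intros algebra_simps)+

end

lift_definition bg_scale :: "'k::field \<Rightarrow> 'k bg \<Rightarrow> 'k bg" is pm_scale
  unfolding bg_rel_def by (metis bg_null_intros(4) pm.scale_right_diff_distrib)

global_interpretation bg: vector_space "bg_scale :: 'k::field \<Rightarrow> _"
  by unfold_locales
    (transfer, simp add: bg_rel_def bg_null_intros pm.scale_right_distrib pm.scale_left_distrib)+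

definition bg_component :: "nat \<Rightarrow> 'k::field bg set" where
  "bg_component n = abs_bg ` free_op n"

lemma abs_bg_eq_iff:
  assumes "p \<in> free_op n" "q \<in> free_op n"
  shows "abs_bg p = abs_bg q \<longleftrightarrow> bg_ideal n (p - q)"
proof
  assume "bg_ideal n (p - q)"
  then have "p - q \<in> bg_null" by (auto simp: bg_null_def intro!: pm.span_base)
  then show "abs_bg p = abs_bg q" by (simp add: bg.abs_eq_iff bg_rel_def)
next
  assume "abs_bg p = abs_bg q"
  then have null: "p - q \<in> bg_null" by (simp add: bg.abs_eq_iff bg_rel_def)
  define h :: "(pbt \<Rightarrow>\<^sub>0 'a) \<Rightarrow> (pbt \<Rightarrow>\<^sub>0 'a)"
    where "h = lin_ext pm_scale (\<lambda>t. if leaves t = n then basis_vec t else 0)"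
  have lin: "Vector_Spaces.linear pm_scale pm_scale h"
    unfolding h_def by (rule pm.linear_lin_ext)
  then interpret h: Vector_Spaces.linear pm_scale pm_scale h .
  have h_same: "h r = r" if "r \<in> free_op n" for r
    by (rule linear_eq_on_basis[OF lin pm.linear_ident])
      (use that in \<open>auto simp: h_def free_op_def\<close>)
  have h_other: "h r = 0" if "r \<in> free_op m" "m \<noteq> n" for r m
    using that by (auto simp: h_def free_op_def lin_ext_def intro!: sum.neutral)
  have "pm.subspace {r. bg_ideal n (h r)}"
    unfolding pm.subspace_def by (auto simp: h.add h.scale h.zero intro: bg_ideal.intros)
  moreover have "bg_ideal n (h r)" if "\<exists>m. bg_ideal m r" for r
    using that h_same h_other by (metis bg_ideal_free_op bg_ideal.zero)
  ultimately have "bg_ideal n (h (p - q))"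
    using pm.span_minimal[of "{r. \<exists>m. bg_ideal m r}" "{r. bg_ideal n (h r)}"] null
    by (auto simp: bg_null_def)
  then show "bg_ideal n (p - q)"
    using h_same pm.subspace_diff[OF subspace_free_op assms] by simp
qed


section \<open>Bigraft algebras\<close>

locale bg_algebra = vector_space scale
  for scale :: "'k::field \<Rightarrow> 'a::ab_group_add \<Rightarrow> 'a" +
  fixes ast succ prec :: "'a \<Rightarrow> 'a \<Rightarrow> 'a"
  assumes linear_ast: "Vector_Spaces.linear scale scale (ast x)"
      "Vector_Spaces.linear scale scale (\<lambda>x. ast x y)"
    and linear_succ: "Vector_Spaces.linear scale scale (succ x)"
      "Vector_Spaces.linear scale scale (\<lambda>x. succ x y)"
    and linear_prec: "Vector_Spaces.linear scale scale (prec x)"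
      "Vector_Spaces.linear scale scale (\<lambda>x. prec x y)"
    and ast_ast: "ast (ast x y) z = ast x (ast y z)"
    and ast_succ: "succ (ast x y) z = succ x (succ y z)"
    and succ_ast: "ast (succ x y) z = succ x (ast y z)"
    and prec_prec: "prec (prec x y) z = prec x (ast y z)"
    and ast_prec: "prec (ast x y) z = ast x (prec y z)"
    and succ_prec: "prec (succ x y) z = succ x (prec y z)"
begin

primrec gen_act :: "bg_gen \<Rightarrow> 'a \<Rightarrow> 'a \<Rightarrow> 'a" where
  "gen_act Ast = ast"
| "gen_act Succ = succ"
| "gen_act Prec = prec"

primrec tree_act :: "pbt \<Rightarrow> 'a list \<Rightarrow> 'a" where
  "tree_act Leaf xs = hd xs"
| "tree_act (Node g s t) xs =
     gen_act g (tree_act s (take (leaves s) xs)) (tree_act t (drop (leaves s) xs))"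

definition free_act :: "(pbt \<Rightarrow>\<^sub>0 'k) \<Rightarrow> 'a list \<Rightarrow> 'a" where
  "free_act p xs = lin_ext scale (\<lambda>t. if leaves t = length xs then tree_act t xs else 0) p"

text \<open>\<open>act p [a\<^sub>1, \<dots>, a\<^sub>n]\<close> is \<open>p.(a\<^sub>1, \<dots>, a\<^sub>n)\<close> for \<open>p\<close> of arity \<open>n\<close>. The choice of the
  representative is irrelevant by \<open>act_abs_bg\<close>.\<close>

definition act :: "'k bg \<Rightarrow> 'a list \<Rightarrow> 'a" where
  "act p xs = free_act (rep_bg p) xs"

lemma linear_gen_act:
  "Vector_Spaces.linear scale scale (gen_act g x)"
  "Vector_Spaces.linear scale scale (\<lambda>x. gen_act g x y)"
  by (cases g; simp add: linear_ast linear_succ linear_prec)+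

lemma linear_free_act: "Vector_Spaces.linear pm_scale scale (\<lambda>p. free_act p xs)"
  unfolding free_act_def by (rule linear_lin_ext)

lemma free_act_basis_vec: "leaves t = length xs \<Longrightarrow> free_act (basis_vec t) xs = tree_act t xs"
  by (simp add: free_act_def)

lemma linear_tree_act:
  "length xs + length ys + 1 = leaves s \<Longrightarrow>
    Vector_Spaces.linear scale scale (\<lambda>x. tree_act s (xs @ x # ys))"
proof (induction s arbitrary: xs ys)
  case Leaf
  then show ?case by (simp add: linear_ident)
next
  case (Node g a b)
  note comp = Vector_Spaces.linear_compose[unfolded o_def]
  show ?case
  proof (cases "length xs < leaves a")
    case True
    then obtain k where k: "leaves a - length xs = Suc k" by (metis Suc_diff_Suc)
    have "Vector_Spaces.linear scale scale (\<lambda>x. tree_act a (xs @ x # take k ys))"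
      by (rule Node.IH(1)) (use Node.prems k in auto)
    from comp[OF this linear_gen_act(2)] show ?thesis
      using True k by simp
  next
    case False
    have "Vector_Spaces.linear scale scale (\<lambda>x. tree_act b (drop (leaves a) xs @ x # ys))"
      by (rule Node.IH(2)) (use Node.prems False in auto)
    from comp[OF this linear_gen_act(1)] show ?thesis
      using False by simp
  qed
qed

lemma tree_act_graft:
  "i < leaves s \<Longrightarrow> length xs = leaves s + leaves t - 1 \<Longrightarrow>
    tree_act (graft i s t) xs =
      tree_act s (take i xs @ tree_act t (take (leaves t) (drop i xs)) # drop (i + leaves t) xs)"
proof (induction s arbitrary: i xs)
  case Leaf
  then show ?case by simp
next
  case (Node g a b)
  have pos: "leaves a > 0" "leaves b > 0" "leaves t > 0" by simp_all
  show ?case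
  proof (cases "i < leaves a")
    case True
    let ?k = "leaves a + leaves t - 1"
    obtain k where k: "leaves a - i = Suc k" using True by (metis Suc_diff_Suc)
    have arith: "min i ?k = i" "min (leaves t) (?k - i) = leaves t" "?k - (i + leaves t) = k"
      using k pos True by linarith+
    have "take i (take ?k xs) = take i xs"
      by (simp only: take_take arith)
    moreover have "take (leaves t) (drop i (take ?k xs)) = take (leaves t) (drop i xs)"
      by (simp only: drop_take take_take arith)
    moreover have "drop (i + leaves t) (take ?k xs) = take k (drop (i + leaves t) xs)"
      by (simp only: drop_take arith)
    moreover have "length (take ?k xs) = ?k"
      using Node.prems by simp
    ultimately have "tree_act (graft i a t) (take ?k xs) =
        tree_act a (take i xs @ tree_act t (take (leaves t) (drop i xs)) # take k (drop (i + leaves t) xs))"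
      using Node.IH(1)[of i "take ?k xs"] True by simp
    moreover have "drop ?k xs = drop k (drop (i + leaves t) xs)"
    proof -
      have "?k = k + (i + leaves t)" using k pos True by linarith
      then show ?thesis by (simp only: drop_drop)
    qed
    moreover have "length (take i xs) = i" using Node.prems by simp
    ultimately show ?thesis
      using True k by (simp add: leaves_graft)
  next
    case False
    have "take (i - leaves a) (drop (leaves a) xs) = drop (leaves a) (take i xs)"
      by (simp only: drop_take)
    moreover have "drop (i - leaves a) (drop (leaves a) xs) = drop i xs"
      "drop (i - leaves a + leaves t) (drop (leaves a) xs) = drop (i + leaves t) xs"
      using False by simp_all
    moreover have "i - leaves a < leaves b" "length (drop (leaves a) xs) = leaves b + leaves t - 1"
      using False Node.prems pos by simp_all
    ultimately have "tree_act (graft (i - leaves a) b t) (drop (leaves a) xs) =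
        tree_act b (drop (leaves a) (take i xs) @
          tree_act t (take (leaves t) (drop i xs)) # drop (i + leaves t) xs)"
      using Node.IH(2)[of "i - leaves a" "drop (leaves a) xs"] by simp
    moreover have "length (take i xs) = i" "min (leaves a) i = leaves a"
      using False Node.prems by simp_all
    ultimately show ?thesis
      using False by (simp add: take_append)
  qed
qed

lemma free_act_pcomp:
  assumes "p \<in> free_op n" "q \<in> free_op m" "i < n" "length xs = n + m - 1"
  shows "free_act (pcomp i p q) xs =
    free_act p (take i xs @ free_act q (take m (drop i xs)) # drop (i + m) xs)"
proof -
  note comp = Vector_Spaces.linear_compose[unfolded o_def]
  have basis: "free_act (pcomp i (basis_vec s) q) xs =
      free_act (basis_vec s) (take i xs @ free_act q (take m (drop i xs)) # drop (i + m) xs)"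
    if s: "leaves s = n" for s
  proof -
    have "free_act (pcomp i (basis_vec s) q) xs =
        tree_act s (take i xs @ free_act q (take m (drop i xs)) # drop (i + m) xs)"
    proof (rule linear_eq_on_basis[where p = q
          and g = "\<lambda>q. free_act (pcomp i (basis_vec s) q) xs"
          and h = "\<lambda>q. tree_act s (take i xs @ free_act q (take m (drop i xs)) # drop (i + m) xs)"])
      show "Vector_Spaces.linear pm_scale scale (\<lambda>q. free_act (pcomp i (basis_vec s) q) xs)"
        by (rule comp[OF linear_bilin_ext_right[of "graft i" "basis_vec s", folded pcomp_def] linear_free_act])
      have "Vector_Spaces.linear scale scale (\<lambda>x. tree_act s (take i xs @ x # drop (i + m) xs))"
        by (rule linear_tree_act) (use assms s in auto)
      then show "Vector_Spaces.linear pm_scale scale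
          (\<lambda>q. tree_act s (take i xs @ free_act q (take m (drop i xs)) # drop (i + m) xs))"
        by (rule comp[OF linear_free_act[of "take m (drop i xs)"]])
      fix t assume "t \<in> Poly_Mapping.keys q"
      then have "leaves t = m" using assms by (auto simp: free_op_def)
      then show "free_act (pcomp i (basis_vec s) (basis_vec t)) xs =
          tree_act s (take i xs @ free_act (basis_vec t) (take m (drop i xs)) # drop (i + m) xs)"
        using assms(3,4) s
        by (simp add: pcomp_def free_act_basis_vec leaves_graft tree_act_graft)
    qed
    also have "\<dots> =
        free_act (basis_vec s) (take i xs @ free_act q (take m (drop i xs)) # drop (i + m) xs)"
      by (rule free_act_basis_vec[symmetric]) (use assms s in auto)
    finally show ?thesis .
  qed
  show ?thesis
  proof (rule linear_eq_on_basis[where g = "\<lambda>p. free_act (pcomp i p q) xs" and p = p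
        and h = "\<lambda>p. free_act p (take i xs @ free_act q (take m (drop i xs)) # drop (i + m) xs)"])
    show "Vector_Spaces.linear pm_scale scale (\<lambda>p. free_act (pcomp i p q) xs)"
      by (rule comp[OF linear_bilin_ext_left[of "graft i" q, folded pcomp_def] linear_free_act])
    show "Vector_Spaces.linear pm_scale scale
        (\<lambda>p. free_act p (take i xs @ free_act q (take m (drop i xs)) # drop (i + m) xs))"
      by (rule linear_free_act)
    fix s assume "s \<in> Poly_Mapping.keys p"
    then have "leaves s = n" using assms(1) by (simp add: free_op_def)
    then show "free_act (pcomp i (basis_vec s) q) xs =
        free_act (basis_vec s) (take i xs @ free_act q (take m (drop i xs)) # drop (i + m) xs)"
      by (rule basis)
  qed
qed

lemma free_act_ideal: "bg_ideal n p \<Longrightarrow> length xs = n \<Longrightarrow> free_act p xs = 0"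
proof (induction arbitrary: xs rule: bg_ideal.induct)
  case (relator r)
  then obtain x y z where xs: "xs = [x, y, z]"
    by (auto simp: length_Suc_conv eval_nat_numeral)
  interpret l: Vector_Spaces.linear pm_scale scale "\<lambda>p. free_act p xs" by (rule linear_free_act)
  from relator(1) show ?case
    by (auto simp: bg_relators_def l.diff lcomp_def rcomp_def)
      (simp_all add: xs free_act_basis_vec ast_ast ast_succ succ_ast prec_prec ast_prec succ_prec)
next
  case (zero n)
  interpret l: Vector_Spaces.linear pm_scale scale "\<lambda>p. free_act p xs" by (rule linear_free_act)
  show ?case by (rule l.zero)
next
  case (add n p q)
  interpret l: Vector_Spaces.linear pm_scale scale "\<lambda>p. free_act p xs" by (rule linear_free_act)
  show ?case using add by (simp add: l.add)
next
  case (scale n p c)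
  interpret l: Vector_Spaces.linear pm_scale scale "\<lambda>p. free_act p xs" by (rule linear_free_act)
  show ?case using scale by (simp add: l.scale)
next
  case (comp_left n p q m i)
  then show ?case
    by (subst free_act_pcomp[OF bg_ideal_free_op]) auto
next
  case (comp_right q n m p i)
  have "m > 0 \<or> p = 0"
    using bg_ideal_free_op[OF comp_right(2)] leaves_pos
    by (auto simp: free_op_def simp del: leaves_pos intro!: poly_mapping_eqI) (metis in_keys_iff less_numeral_extra(3))
  then show ?case
  proof
    assume "m > 0"
    then have "free_act p (take m (drop i xs)) = 0"
      using comp_right by (intro comp_right.IH) auto
    moreover have "tree_act s (take i xs @ 0 # drop (i + m) xs) = 0" if "leaves s = n" for s
    proof -
      have "Vector_Spaces.linear scale scale (\<lambda>x. tree_act s (take i xs @ x # drop (i + m) xs))"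
        by (rule linear_tree_act) (use comp_right that in auto)
      then interpret l: Vector_Spaces.linear scale scale
        "\<lambda>x. tree_act s (take i xs @ x # drop (i + m) xs)" .
      show ?thesis by (rule l.zero)
    qed
    ultimately show ?thesis
      using comp_right(1)
      by (subst free_act_pcomp[OF comp_right(1) bg_ideal_free_op[OF comp_right(2)] comp_right(3) comp_right.prems])
        (auto simp: free_act_def lin_ext_def free_op_def intro!: sum.neutral)
  next
    assume "p = 0"
    then show ?thesis by (simp add: pcomp_def bilin_ext_def lin_ext_def free_act_def)
  qed
qed

lemma act_abs_bg: "act (abs_bg p) xs = free_act p xs"
proof -
  interpret l: Vector_Spaces.linear pm_scale scale "\<lambda>p. free_act p xs" by (rule linear_free_act)
  have "free_act r xs = 0" if r: "bg_ideal n r" for n r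
  proof (cases "length xs = n")
    case True
    then show ?thesis using free_act_ideal r by blast
  next
    case False
    then show ?thesis
      using bg_ideal_free_op[OF r]
      by (auto simp: free_act_def lin_ext_def free_op_def intro!: sum.neutral)
  qed
  then have "{r. \<exists>n. bg_ideal n r} \<subseteq> {r. free_act r xs = 0}" by blast
  moreover have "pm.subspace {r. free_act r xs = 0}"
    unfolding pm.subspace_def by (auto simp: l.add l.scale l.zero)
  ultimately have null: "bg_null \<subseteq> {r. free_act r xs = 0}"
    unfolding bg_null_def by (rule pm.span_minimal)
  have "bg_rel (rep_bg (abs_bg p)) p"
    using Quotient3_bg by (metis Quotient3_rep_abs equivp_bg_rel equivp_reflp)
  then have "free_act (rep_bg (abs_bg p) - p) xs = 0"
    using null by (auto simp: bg_rel_def)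
  then show ?thesis by (simp add: act_def l.diff)
qed

end


section \<open>Forests with decorated edges\<close>

datatype edge = L | R

text \<open>A planar rooted tree with decorated edges: each child of the root is listed with the
  decoration of the edge that leads to it.\<close>

datatype ptree = Vertex "(edge \<times> ptree) list"

primrec tdegree :: "ptree \<Rightarrow> nat" where
  "tdegree (Vertex es) = Suc (sum_list (map snd (map (map_prod id tdegree) es)))"

definition fdegree :: "ptree list \<Rightarrow> nat" where
  "fdegree F = (\<Sum>t\<leftarrow>F. tdegree t)"

definition B :: "ptree list \<Rightarrow> ptree list \<Rightarrow> ptree" where
  "B F G = Vertex (map (Pair L) F @ map (Pair R) G)"

definition children :: "edge \<Rightarrow> ptree \<Rightarrow> ptree list" where
  "children d t = (case t of Vertex es \<Rightarrow> map snd (filter (\<lambda>e. fst e = d) es))"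

lemma children_B [simp]: "children L (B F G) = F" "children R (B F G) = G"
  by (simp_all add: children_def B_def filter_map o_def)

text \<open>The trees of the form \<open>B(F \<otimes> G)\<close> with all trees of \<open>F\<close> and \<open>G\<close> of this form again, that is, all
  elements of \<open>\<T>\<close> except 1. As a \<^typ>\<open>ptree\<close> always has a root, 1 only occurs as the empty
  forest \<^term>\<open>[]\<close>.\<close>

inductive_set bg_trees :: "ptree set" where
  "F \<in> lists bg_trees \<Longrightarrow> G \<in> lists bg_trees \<Longrightarrow> B F G \<in> bg_trees"

definition bg_forests :: "ptree list set" where
  "bg_forests = lists bg_trees"

definition f_BT :: "nat \<Rightarrow> nat" where
  "f_BT n = card {F \<in> bg_forests. fdegree F = n}"

lemma children_bg_trees: "t \<in> bg_trees \<Longrightarrow> children d t \<in> lists bg_trees"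
  by (cases d) (auto elim!: bg_trees.cases)

lemma B_children: "t \<in> bg_trees \<Longrightarrow> B (children L t) (children R t) = t"
  by (auto elim!: bg_trees.cases)

lemma finite_edge_lists_degree:
  assumes "finite {F. fdegree F = n}"
  shows "finite {es :: (edge \<times> ptree) list. fdegree (map snd es) = n}"
proof -
  have fin: "finite (UNIV :: edge set)"
    by (rule finite_subset[of _ "{L, R}"]) (auto intro: edge.exhaust)
  have "{es :: (edge \<times> ptree) list. fdegree (map snd es) = n} \<subseteq>
      (\<Union>F\<in>{F. fdegree F = n}. (\<lambda>ds. zip ds F) ` {ds. set ds \<subseteq> UNIV \<and> length ds = length F})"
  proof
    fix es :: "(edge \<times> ptree) list" assume "es \<in> {es. fdegree (map snd es) = n}"
    moreover have "es = zip (map fst es) (map snd es)" by (simp add: zip_map_fst_snd)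
    ultimately show "es \<in> (\<Union>F\<in>{F. fdegree F = n}.
        (\<lambda>ds. zip ds F) ` {ds. set ds \<subseteq> UNIV \<and> length ds = length F})"
      by (intro UN_I[of "map snd es"]) (auto intro!: image_eqI[of _ _ "map fst es"])
  qed
  moreover have "finite \<dots>"
    using assms fin by (intro finite_UN_I finite_imageI finite_lists_length_eq)
  ultimately show ?thesis by (rule finite_subset)
qed

lemma finite_forests_degree: "finite {F. fdegree F = n}"
proof (induction n rule: less_induct)
  case (less n)
  let ?E = "\<lambda>k. {es :: (edge \<times> ptree) list. fdegree (map snd es) = k}"
  have "{F. fdegree F = n} \<subseteq>
      insert [] (\<Union>k\<in>{..<n}. \<Union>j\<in>{..<n}. (\<lambda>(es, F). Vertex es # F) ` (?E k \<times> {F. fdegree F = j}))"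
  proof
    fix F assume F: "F \<in> {F. fdegree F = n}"
    show "F \<in> insert [] (\<Union>k\<in>{..<n}. \<Union>j\<in>{..<n}. (\<lambda>(es, F). Vertex es # F) ` (?E k \<times> {F. fdegree F = j}))"
    proof (cases F)
      case (Cons t G)
      obtain es where t: "t = Vertex es" by (cases t)
      have "n = Suc (fdegree (map snd es)) + fdegree G"
        using F Cons t by (simp add: fdegree_def o_def)
      then show ?thesis using Cons t by (auto simp: image_iff)
    qed simp
  qed
  moreover have "finite \<dots>"
    using less finite_edge_lists_degree by auto
  ultimately show ?case by (rule finite_subset)
qed

text \<open>As \<open>f_BT\<close> is positive, \<open>bg.dim V = f_BT n\<close> forces \<open>V\<close> to be finite dimensional, although
  \<open>dim\<close> is 0 on infinite dimensional spaces.\<close>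

lemma f_BT_pos: "f_BT n > 0"
proof -
  have "replicate n (B [] []) \<in> {F \<in> bg_forests. fdegree F = n}"
    by (auto simp: bg_forests_def fdegree_def B_def sum_list_replicate
        intro: bg_trees.intros[of "[]" "[]", unfolded B_def, simplified])
  moreover have "finite {F \<in> bg_forests. fdegree F = n}"
    using finite_forests_degree[of n] by (rule finite_subset[rotated]) auto
  ultimately show ?thesis
    unfolding f_BT_def by (auto simp: card_gt_0_iff)
qed


section \<open>The bigraft algebra of forests\<close>

typedef bgforest = "bg_forests - {[]}"
proof
  have "B [] [] \<in> bg_trees" by (rule bg_trees.intros) auto
  then show "[B [] []] \<in> bg_forests - {[]}" by (simp add: bg_forests_def)
qed

setup_lifting type_definition_bgforest

lift_definition forest_ast :: "bgforest \<Rightarrow> bgforest \<Rightarrow> bgforest" is "(@)"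
  by (auto simp: bg_forests_def)

text \<open>\<open>forest_succ G F\<close> is \<open>G \<succ> F\<close>, and \<open>forest_prec G F\<close> is \<open>G \<prec> F\<close>.\<close>

lift_definition forest_succ :: "bgforest \<Rightarrow> bgforest \<Rightarrow> bgforest" is
  "\<lambda>G F. B (G @ children L (hd F)) (children R (hd F)) # tl F"
proof -
  fix G F assume "G \<in> bg_forests - {[]}" "F \<in> bg_forests - {[]}"
  then have "G \<in> lists bg_trees" "hd F \<in> bg_trees" "tl F \<in> lists bg_trees"
    by (cases F; simp add: bg_forests_def)+
  then show "B (G @ children L (hd F)) (children R (hd F)) # tl F \<in> bg_forests - {[]}"
    using children_bg_trees[of "hd F" L] children_bg_trees[of "hd F" R]
    by (auto simp: bg_forests_def intro!: bg_trees.intros)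
qed

lift_definition forest_prec :: "bgforest \<Rightarrow> bgforest \<Rightarrow> bgforest" is
  "\<lambda>G F. butlast G @ [B (children L (last G)) (children R (last G) @ F)]"
proof -
  fix G F assume "G \<in> bg_forests - {[]}" "F \<in> bg_forests - {[]}"
  then have "F \<in> lists bg_trees" "last G \<in> bg_trees" "butlast G \<in> lists bg_trees"
    by (auto simp: bg_forests_def dest: in_set_butlastD)
  then show "butlast G @ [B (children L (last G)) (children R (last G) @ F)] \<in> bg_forests - {[]}"
    using children_bg_trees[of "last G" L] children_bg_trees[of "last G" R]
    by (auto simp: bg_forests_def intro!: bg_trees.intros)
qed

lift_definition bgforest_degree :: "bgforest \<Rightarrow> nat" is fdegree .

lift_definition forest_bullet :: bgforest is "[B [] []]"
  by (auto simp: bg_forests_def intro: bg_trees.intros)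

text \<open>The vector space \<open>\<M>\<close> is \<^typ>\<open>bgforest \<Rightarrow>\<^sub>0 'k\<close>.\<close>

global_interpretation M: bg_algebra "pm_scale :: 'k::field \<Rightarrow> (bgforest \<Rightarrow>\<^sub>0 'k) \<Rightarrow> _"
    "bilin_ext forest_ast" "bilin_ext forest_succ" "bilin_ext forest_prec"
  defines M_act = M.act
proof (intro bg_algebra.intro bg_algebra_axioms.intro, goal_cases)
  case 1 show ?case by (rule pm.vector_space_axioms)
next
  case (2 x) show ?case by (rule linear_bilin_ext_right)
next
  case (3 y) show ?case by (rule linear_bilin_ext_left)
next
  case (4 x) show ?case by (rule linear_bilin_ext_right)
next
  case (5 y) show ?case by (rule linear_bilin_ext_left)
next
  case (6 x) show ?case by (rule linear_bilin_ext_right)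
next
  case (7 y) show ?case by (rule linear_bilin_ext_left)
next
  case 8 show ?case by (rule bilin_ext_assoc, transfer) simp
next
  case 9 show ?case by (rule bilin_ext_assoc, transfer) simp
next
  case 10 show ?case by (rule bilin_ext_assoc, transfer) simp
next
  case 11 show ?case by (rule bilin_ext_assoc, transfer) simp
next
  case 12 show ?case by (rule bilin_ext_assoc, transfer) (simp add: butlast_append)
next
  case 13 show ?case by (rule bilin_ext_assoc, transfer) (auto simp: neq_Nil_conv)
qed

definition M_component :: "nat \<Rightarrow> (bgforest \<Rightarrow>\<^sub>0 'k::field) set" where
  "M_component n = pm.span (basis_vec ` {F. bgforest_degree F = n})"

definition Psi :: "nat \<Rightarrow> 'k::field bg \<Rightarrow> (bgforest \<Rightarrow>\<^sub>0 'k)" where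
  "Psi n p = M_act p (replicate n (basis_vec forest_bullet))"

end

theory Submission
  imports Defs
begin

text \<open>
Each relator of the operad is a difference of two planar binary trees, so the ideal identifies
basis trees with one another and nothing more: the quotient is the linear span of the classes of
binary trees, called words here, under the congruence \<open>bg_cong\<close> generated by the six relations.
Likewise the operations of \<open>\<M>\<close> send basis forests to basis forests. The theorem is thus a statement
about sets: evaluating words at the one-vertex tree identifies classes of words with forests.

For the inverse, every nonempty forest of \<open>\<F>\<close> gets a normal word. The tree \<open>B(F \<otimes> G)\<close> is read
as \<open>F \<succ> (\<bullet> \<prec> G)\<close>, with the empty factors left out, and a forest is the right-nested \<open>\<ast>\<close>-product
of its trees. Evaluating the normal word gives the forest back (\<open>word_forest_normal_word\<close>).
Conversely, the product of two normal words is congruent to the normal word of the product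
(\<open>normal_word_ast\<close>, \<open>normal_word_succ\<close>, \<open>normal_word_prec\<close>), hence every word is congruent to the
normal word of its value (\<open>bg_cong_normal_word\<close>). Normal words of distinct forests are
never identified, because \<open>\<M>\<close> is a model of the relations in which distinct forests are linearly
independent.

Extending normal words linearly gives a two-sided inverse of \<open>\<Psi>\<close> in each arity
(\<open>normal_rep_Psi\<close>, \<open>Psi_normal_rep\<close>). It carries the basis of forests of degree \<open>n\<close> to a basis of
the component of arity \<open>n\<close>, which gives the dimension.
\<close>

section \<open>The congruence of bigraft words\<close>

inductive bg_cong :: "pbt \<Rightarrow> pbt \<Rightarrow> bool" where
  refl [simp, intro]: "bg_cong s s"
| sym: "bg_cong s t \<Longrightarrow> bg_cong t s"
| trans [trans]: "bg_cong s t \<Longrightarrow> bg_cong t u \<Longrightarrow> bg_cong s u"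
| node: "bg_cong s s' \<Longrightarrow> bg_cong t t' \<Longrightarrow> bg_cong (Node g s t) (Node g s' t')"
| ast_ast: "bg_cong (Node Ast (Node Ast x y) z) (Node Ast x (Node Ast y z))"
| ast_succ: "bg_cong (Node Succ (Node Ast x y) z) (Node Succ x (Node Succ y z))"
| succ_ast: "bg_cong (Node Ast (Node Succ x y) z) (Node Succ x (Node Ast y z))"
| prec_prec: "bg_cong (Node Prec (Node Prec x y) z) (Node Prec x (Node Ast y z))"
| ast_prec: "bg_cong (Node Prec (Node Ast x y) z) (Node Ast x (Node Prec y z))"
| succ_prec: "bg_cong (Node Prec (Node Succ x y) z) (Node Succ x (Node Prec y z))"

lemma bg_cong_leaves: "bg_cong s t \<Longrightarrow> leaves s = leaves t"
  by (induction rule: bg_cong.induct) auto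

lemma pcomp_diff_left: "pcomp i (p - p') q = pcomp i p q - pcomp i p' q"
proof -
  interpret Vector_Spaces.linear pm_scale pm_scale "\<lambda>p. pcomp i p q"
    unfolding pcomp_def by (rule linear_bilin_ext_left)
  show ?thesis by (rule diff)
qed

lemma pcomp_diff_right: "pcomp i p (q - q') = pcomp i p q - pcomp i p q'"
proof -
  interpret Vector_Spaces.linear pm_scale pm_scale "pcomp i p"
    unfolding pcomp_def by (rule linear_bilin_ext_right)
  show ?thesis by (rule diff)
qed

lemma pcomp_basis_vec [simp]: "pcomp i (basis_vec s) (basis_vec t) = basis_vec (graft i s t)"
  by (simp add: pcomp_def)

text \<open>A tree \<open>Node g s t\<close> is \<open>s\<close> grafted on the first leaf of \<open>Node g Leaf t\<close>, so the ideal absorbs this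
  change of context; the last leaf of \<open>Node g s Leaf\<close> serves in the same way for \<open>t\<close>.\<close>

lemma bg_ideal_node_left:
  assumes "bg_ideal (leaves s) (basis_vec s - basis_vec s' :: pbt \<Rightarrow>\<^sub>0 'k::field)"
  shows "bg_ideal (leaves (Node g s t)) (basis_vec (Node g s t) - basis_vec (Node g s' t) :: pbt \<Rightarrow>\<^sub>0 'k)"
  using bg_ideal.comp_right[of "basis_vec (Node g Leaf t)" "Suc (leaves t)", OF _ assms, of 0]
  by (simp add: basis_vec_free_op pcomp_diff_right add.commute)

lemma bg_ideal_node_right:
  assumes "bg_ideal (leaves t) (basis_vec t - basis_vec t' :: pbt \<Rightarrow>\<^sub>0 'k::field)"
  shows "bg_ideal (leaves (Node g s t)) (basis_vec (Node g s t) - basis_vec (Node g s t') :: pbt \<Rightarrow>\<^sub>0 'k)"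
  using bg_ideal.comp_right[of "basis_vec (Node g s Leaf)" "Suc (leaves s)", OF _ assms, of "leaves s"]
  by (simp add: basis_vec_free_op pcomp_diff_right)

text \<open>Closure of the ideal under partial composition turns a relator, which only has leaves as arguments,
  into its instances at arbitrary trees.\<close>

lemma bg_ideal_relator_instance:
  assumes "(lcomp a b - rcomp c d :: pbt \<Rightarrow>\<^sub>0 'k::field) \<in> bg_relators"
  shows "bg_ideal (leaves x + leaves y + leaves z)
    (basis_vec (Node a (Node b x y) z) - basis_vec (Node c x (Node d y z)) :: pbt \<Rightarrow>\<^sub>0 'k)"
proof -
  have fill: "bg_ideal (n + leaves u - 1) (pcomp i p (basis_vec u))"
    if "bg_ideal n p" "i < n" for n i u and p :: "pbt \<Rightarrow>\<^sub>0 'k"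
    using bg_ideal.comp_left[OF that(1) _ that(2)] by (simp add: basis_vec_free_op)
  have pos: "leaves x > 0" "leaves y > 0" "leaves z > 0" by simp_all
  \<comment> \<open>Filling the leaves from right to left keeps the positions of those still to be filled.\<close>
  have "bg_ideal (3 + leaves z - 1 + leaves y - 1 + leaves x - 1)
     (pcomp 0 (pcomp 1 (pcomp 2 (lcomp a b - rcomp c d) (basis_vec z)) (basis_vec y)) (basis_vec x)
       :: pbt \<Rightarrow>\<^sub>0 'k)"
    by (intro fill bg_ideal.relator assms) simp_all
  also have "3 + leaves z - 1 + leaves y - 1 + leaves x - 1 = leaves x + leaves y + leaves z"
    using pos by linarith
  finally show ?thesis
    by (simp add: lcomp_def rcomp_def pcomp_diff_left)
qed

lemma bg_cong_bg_ideal: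
  "bg_cong s t \<Longrightarrow> bg_ideal (leaves s) (basis_vec s - basis_vec t :: pbt \<Rightarrow>\<^sub>0 'k::field)"
proof (induction rule: bg_cong.induct)
  case (refl s)
  show ?case by (simp add: bg_ideal.zero)
next
  case (sym s t)
  from bg_ideal.scale[OF sym.IH, of "-1"] show ?case
    using bg_cong_leaves[OF sym.hyps] by simp
next
  case (trans s t u)
  from bg_ideal.add[OF trans.IH(1), of "basis_vec t - basis_vec u"] trans.IH(2) show ?case
    using bg_cong_leaves[OF trans.hyps(1)] by simp
next
  case (node s s' t t' g)
  have "bg_ideal (leaves (Node g s' t)) (basis_vec (Node g s' t) - basis_vec (Node g s' t') :: pbt \<Rightarrow>\<^sub>0 'k)"
    by (rule bg_ideal_node_right) (rule node.IH)
  moreover have "bg_ideal (leaves (Node g s t)) (basis_vec (Node g s t) - basis_vec (Node g s' t) :: pbt \<Rightarrow>\<^sub>0 'k)"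
    by (rule bg_ideal_node_left) (rule node.IH)
  ultimately have "bg_ideal (leaves (Node g s t))
      ((basis_vec (Node g s t) - basis_vec (Node g s' t)) +
       (basis_vec (Node g s' t) - basis_vec (Node g s' t')) :: pbt \<Rightarrow>\<^sub>0 'k)"
    using bg_cong_leaves[OF node.hyps(1)] by (intro bg_ideal.add) simp_all
  then show ?case by simp
qed (simp_all only: leaves.simps add.assoc[symmetric],
    (rule bg_ideal_relator_instance, simp add: bg_relators_def)+)

lemma bg_cong_abs_bg: "bg_cong s t \<Longrightarrow> (abs_bg (basis_vec s) :: 'k::field bg) = abs_bg (basis_vec t)"
  using bg_cong_bg_ideal[of s t] bg_cong_leaves[of s t]
  by (subst abs_bg_eq_iff[where n = "leaves s"]) (simp_all add: basis_vec_free_op)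


section \<open>Normal words of forests\<close>

text \<open>The word \<open>u \<succ> (\<bullet> \<prec> v)\<close> of \<open>B(F \<otimes> G)\<close>, given words \<open>u\<close> of \<open>F\<close> and \<open>v\<close> of \<open>G\<close>. The operad has no
  unit, so a factor that belongs to an empty forest has to be left out.\<close>

definition vertex_word :: "ptree list \<Rightarrow> ptree list \<Rightarrow> pbt \<Rightarrow> pbt \<Rightarrow> pbt" where
  "vertex_word F G u v =
     (let x = if G = [] then Leaf else Node Prec Leaf v
      in if F = [] then x else Node Succ u x)"

lemma fdegree_simps [simp]: "fdegree [] = 0" "fdegree (t # F) = tdegree t + fdegree F"
    "fdegree (F @ G) = fdegree F + fdegree G"
  by (simp_all add: fdegree_def)

lemma tdegree_B: "tdegree (B F G) = Suc (fdegree F + fdegree G)"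
  by (simp add: B_def fdegree_def o_def)

lemma fdegree_children_less: "fdegree (children d t) < tdegree t"
proof (cases t)
  case (Vertex es)
  have "fdegree (map snd (filter P es)) \<le> fdegree (map snd es)" for P
    by (induction es) auto
  then show ?thesis
    using Vertex by (simp add: children_def fdegree_def o_def less_Suc_eq_le)
qed

lemma tdegree_pos: "tdegree t > 0"
  by (cases t) simp

text \<open>Every word has positive arity, so the empty forest has none; \<open>Leaf\<close> is a default value.\<close>

function normal_word :: "ptree list \<Rightarrow> pbt" where
  "normal_word [] = Leaf"
| "normal_word (t # F) =
     (let s = vertex_word (children L t) (children R t)
                (normal_word (children L t)) (normal_word (children R t))
      in if F = [] then s else Node Ast s (normal_word F))"
  by pat_completeness auto
termination
  by (relation "measure fdegree")
    (use fdegree_children_less in \<open>auto simp: tdegree_pos trans_less_add1\<close>)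

declare normal_word.simps(2) [simp del]

lemma normal_word_vertex:
  "normal_word [t] = vertex_word (children L t) (children R t)
     (normal_word (children L t)) (normal_word (children R t))"
  by (simp add: normal_word.simps)

lemma normal_word_Cons: "F \<noteq> [] \<Longrightarrow> normal_word (t # F) = Node Ast (normal_word [t]) (normal_word F)"
  by (simp add: normal_word.simps Let_def)

section \<open>Products of normal words\<close>

lemma normal_word_ast:
  "F \<noteq> [] \<Longrightarrow> G \<noteq> [] \<Longrightarrow> bg_cong (Node Ast (normal_word F) (normal_word G)) (normal_word (F @ G))"
proof (induction F rule: list_nonempty_induct)
  case (single t)
  then show ?case by (simp add: normal_word_Cons)
next
  case (cons t F)
  have "bg_cong (Node Ast (normal_word (t # F)) (normal_word G))
      (Node Ast (normal_word [t]) (Node Ast (normal_word F) (normal_word G)))"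
    using cons by (simp add: normal_word_Cons bg_cong.ast_ast)
  also have "bg_cong \<dots> (normal_word ((t # F) @ G))"
    using cons by (simp add: normal_word_Cons bg_cong.node)
  finally show ?case .
qed

text \<open>If the root already has left children, \<open>G \<succ> (u \<succ> x)\<close> is \<open>(G \<ast> u) \<succ> x\<close>, so that \<open>G\<close> joins them.\<close>

lemma normal_word_succ_vertex:
  assumes "G \<noteq> []"
  shows "bg_cong (Node Succ (normal_word G) (normal_word [t]))
    (normal_word [B (G @ children L t) (children R t)])"
proof (cases "children L t = []")
  case True
  then show ?thesis using assms by (simp add: normal_word_vertex vertex_word_def)
next
  case False
  define x where "x = (if children R t = [] then Leaf else Node Prec Leaf (normal_word (children R t)))"
  have "bg_cong (Node Succ (normal_word G) (Node Succ (normal_word (children L t)) x))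
      (Node Succ (Node Ast (normal_word G) (normal_word (children L t))) x)"
    by (rule bg_cong.sym[OF bg_cong.ast_succ])
  also have "bg_cong \<dots> (Node Succ (normal_word (G @ children L t)) x)"
    using assms False by (intro bg_cong.node normal_word_ast bg_cong.refl)
  finally show ?thesis
    using assms False by (simp add: normal_word_vertex[of t] normal_word_vertex[of "B _ _"]
        vertex_word_def x_def[symmetric])
qed

text \<open>The relation \<open>(x \<succ> y) \<ast> z = x \<succ> (y \<ast> z)\<close>, read from right to left, moves the graft onto the
  first tree alone.\<close>

lemma normal_word_succ:
  assumes "G \<noteq> []" "F \<noteq> []"
  shows "bg_cong (Node Succ (normal_word G) (normal_word F))
    (normal_word (B (G @ children L (hd F)) (children R (hd F)) # tl F))"
proof (cases F)
  case (Cons t F')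
  show ?thesis
  proof (cases "F' = []")
    case True
    then show ?thesis using assms Cons normal_word_succ_vertex by simp
  next
    case False
    have "bg_cong (Node Succ (normal_word G) (Node Ast (normal_word [t]) (normal_word F')))
        (Node Ast (Node Succ (normal_word G) (normal_word [t])) (normal_word F'))"
      by (rule bg_cong.sym[OF bg_cong.succ_ast])
    also have "bg_cong \<dots> (Node Ast (normal_word [B (G @ children L t) (children R t)]) (normal_word F'))"
      using assms by (intro bg_cong.node normal_word_succ_vertex bg_cong.refl)
    finally show ?thesis using Cons False by (simp add: normal_word_Cons)
  qed
qed (use assms in simp)

text \<open>The graft passes through \<open>u \<succ> _\<close> by \<open>(x \<succ> y) \<prec> z = x \<succ> (y \<prec> z)\<close> and then joins the right
  children by \<open>(\<bullet> \<prec> v) \<prec> F = \<bullet> \<prec> (v \<ast> F)\<close>.\<close>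

lemma normal_word_prec_vertex:
  assumes "F \<noteq> []"
  shows "bg_cong (Node Prec (normal_word [t]) (normal_word F))
    (normal_word [B (children L t) (children R t @ F)])"
proof -
  define x where "x = (if children R t = [] then Leaf else Node Prec Leaf (normal_word (children R t)))"
  define y where "y = Node Prec Leaf (normal_word (children R t @ F))"
  have xy: "bg_cong (Node Prec x (normal_word F)) y"
  proof (cases "children R t = []")
    case False
    have "bg_cong (Node Prec x (normal_word F))
        (Node Prec Leaf (Node Ast (normal_word (children R t)) (normal_word F)))"
      using False by (simp add: x_def bg_cong.prec_prec)
    also have "bg_cong \<dots> y"
      unfolding y_def using assms False by (intro bg_cong.node normal_word_ast bg_cong.refl)
    finally show ?thesis .
  qed (simp add: x_def y_def)
  show ?thesis
  proof (cases "children L t = []")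
    case True
    then show ?thesis
      using xy assms by (simp add: normal_word_vertex vertex_word_def x_def y_def)
  next
    case False
    have "bg_cong (Node Prec (Node Succ (normal_word (children L t)) x) (normal_word F))
        (Node Succ (normal_word (children L t)) (Node Prec x (normal_word F)))"
      by (rule bg_cong.succ_prec)
    also have "bg_cong \<dots> (Node Succ (normal_word (children L t)) y)"
      using xy by (intro bg_cong.node bg_cong.refl)
    finally show ?thesis
      using assms False by (simp add: normal_word_vertex[of t] normal_word_vertex[of "B _ _"]
        vertex_word_def x_def[symmetric] y_def[symmetric])
  qed
qed

text \<open>The relation \<open>(x \<ast> y) \<prec> z = x \<ast> (y \<prec> z)\<close> moves the graft past all trees but the last one.\<close>

lemma normal_word_prec:
  assumes "F \<noteq> []"
  shows "G \<noteq> [] \<Longrightarrow> bg_cong (Node Prec (normal_word G) (normal_word F))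
    (normal_word (butlast G @ [B (children L (last G)) (children R (last G) @ F)]))"
proof (induction G rule: list_nonempty_induct)
  case (single t)
  then show ?case using normal_word_prec_vertex[OF assms] by simp
next
  case (cons t G)
  have "bg_cong (Node Prec (normal_word (t # G)) (normal_word F))
      (Node Ast (normal_word [t]) (Node Prec (normal_word G) (normal_word F)))"
    using cons by (simp add: normal_word_Cons bg_cong.ast_prec)
  also have "bg_cong \<dots> (Node Ast (normal_word [t])
      (normal_word (butlast G @ [B (children L (last G)) (children R (last G) @ F)])))"
    using cons.IH by (intro bg_cong.node bg_cong.refl)
  finally show ?case
    using cons by (simp add: normal_word_Cons)
qed

section \<open>Evaluation at the one-vertex tree\<close>

primrec forest_op :: "bg_gen \<Rightarrow> bgforest \<Rightarrow> bgforest \<Rightarrow> bgforest" where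
  "forest_op Ast = forest_ast"
| "forest_op Succ = forest_succ"
| "forest_op Prec = forest_prec"

primrec word_forest :: "pbt \<Rightarrow> bgforest" where
  "word_forest Leaf = forest_bullet"
| "word_forest (Node g s t) = forest_op g (word_forest s) (word_forest t)"

text \<open>The normal words meet every congruence class: by the product lemmas, a word can be
  normalized from its leaves upwards.\<close>

lemma bg_cong_normal_word: "bg_cong t (normal_word (Rep_bgforest (word_forest t)))"
proof (induction t)
  case Leaf
  show ?case by (simp add: forest_bullet.rep_eq normal_word_vertex vertex_word_def)
next
  case (Node g s t)
  have ne: "Rep_bgforest F \<noteq> []" for F using Rep_bgforest[of F] by simp
  have "bg_cong (Node g s t) (Node g (normal_word (Rep_bgforest (word_forest s)))
      (normal_word (Rep_bgforest (word_forest t))))"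
    by (intro bg_cong.node Node.IH)
  also have "bg_cong \<dots> (normal_word (Rep_bgforest (word_forest (Node g s t))))"
    by (cases g) (simp_all add: forest_ast.rep_eq forest_succ.rep_eq forest_prec.rep_eq
        normal_word_ast normal_word_succ normal_word_prec ne)
  finally show ?case .
qed

lemma word_forest_normal_word:
  "F \<in> lists bg_trees \<Longrightarrow> F \<noteq> [] \<Longrightarrow> Rep_bgforest (word_forest (normal_word F)) = F"
proof (induction F rule: normal_word.induct)
  case (2 t F)
  have ch: "children d t \<in> lists bg_trees" for d
    using 2 children_bg_trees by simp
  have "Rep_bgforest (word_forest (normal_word [t])) = [t]"
    using 2 ch B_children[of t]
    by (auto simp: normal_word_vertex vertex_word_def forest_succ.rep_eq forest_prec.rep_eq
        forest_bullet.rep_eq Let_def)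
  moreover have "Rep_bgforest (word_forest (normal_word F)) = F" if "F \<noteq> []"
    using 2 that by simp
  ultimately show ?case
    by (cases "F = []") (simp_all add: normal_word_Cons forest_ast.rep_eq)
qed simp

lemma normal_word_inverse: "word_forest (normal_word (Rep_bgforest F)) = F"
  using Rep_bgforest[of F]
  by (simp add: bg_forests_def word_forest_normal_word flip: Rep_bgforest_inject)

lemma degree_word_forest: "bgforest_degree (word_forest t) = leaves t"
proof (induction t)
  case Leaf
  show ?case by (simp add: bgforest_degree.rep_eq forest_bullet.rep_eq tdegree_B)
next
  case (Node g s t)
  have "bgforest_degree (forest_op g F G) = bgforest_degree F + bgforest_degree G" for F G
  proof -
    have F: "Rep_bgforest F \<noteq> []" "set (Rep_bgforest F) \<subseteq> bg_trees" for F
      using Rep_bgforest[of F] by (auto simp: bg_forests_def)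
    obtain t G' where G: "Rep_bgforest G = t # G'" using F(1) by (meson neq_Nil_conv)
    obtain s F' where F': "Rep_bgforest F = F' @ [s]" using F(1) by (meson rev_exhaust)
    have "tdegree u = Suc (fdegree (children L u) + fdegree (children R u))" if "u \<in> bg_trees" for u
      using B_children[OF that] tdegree_B by metis
    then show ?thesis using F(2)[of F] F(2)[of G] G F'
      by (cases g) (simp_all add: bgforest_degree.rep_eq forest_ast.rep_eq forest_succ.rep_eq
          forest_prec.rep_eq tdegree_B)
  qed
  then show ?case using Node by simp
qed

section \<open>Linearization\<close>

lemma tree_act_bullet:
  "M.tree_act t (replicate (leaves t) (basis_vec forest_bullet)) =
    (basis_vec (word_forest t) :: bgforest \<Rightarrow>\<^sub>0 'k::field)"
proof (induction t)
  case (Node g s t)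
  then show ?case by (cases g) (simp_all add: min_def)
qed simp

lemma Psi_abs_bg:
  "Psi n (abs_bg p) = M.free_act p (replicate n (basis_vec forest_bullet))"
  by (simp add: Psi_def M.act_abs_bg)

lemma Psi_basis_vec:
  "leaves t = n \<Longrightarrow> Psi n (abs_bg (basis_vec t)) = (basis_vec (word_forest t) :: bgforest \<Rightarrow>\<^sub>0 'k::field)"
  using tree_act_bullet[of t] by (simp add: Psi_abs_bg M.free_act_basis_vec)

lemma linear_abs_bg: "Vector_Spaces.linear pm_scale bg_scale abs_bg"
  by (simp add: Vector_Spaces.linear_iff pm.vector_space_axioms bg.vector_space_axioms
      plus_bg.abs_eq bg_scale.abs_eq)

lemma linear_Psi_abs_bg: "Vector_Spaces.linear pm_scale pm_scale (\<lambda>p. Psi n (abs_bg p))"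
  unfolding Psi_abs_bg by (rule M.linear_free_act)

text \<open>The values are representatives in the free operad; their classes give the inverse of \<open>\<Psi>\<close>.\<close>

definition normal_rep :: "(bgforest \<Rightarrow>\<^sub>0 'k::field) \<Rightarrow> (pbt \<Rightarrow>\<^sub>0 'k)" where
  "normal_rep = lin_ext pm_scale (\<lambda>F. basis_vec (normal_word (Rep_bgforest F)))"

lemma linear_normal_rep: "Vector_Spaces.linear pm_scale pm_scale normal_rep"
  unfolding normal_rep_def by (rule pm.linear_lin_ext)

lemma normal_rep_basis_vec [simp]:
  "normal_rep (basis_vec F) = basis_vec (normal_word (Rep_bgforest F))"
  by (simp add: normal_rep_def)

lemma span_basis_vec: "pm.span (basis_vec ` A) = {p :: 'a \<Rightarrow>\<^sub>0 'k::field. Poly_Mapping.keys p \<subseteq> A}"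
proof (rule pm.span_unique)
  show "basis_vec ` A \<subseteq> {p :: 'a \<Rightarrow>\<^sub>0 'k. Poly_Mapping.keys p \<subseteq> A}"
    by (auto simp: basis_vec_def)
  show "pm.subspace {p :: 'a \<Rightarrow>\<^sub>0 'k. Poly_Mapping.keys p \<subseteq> A}"
    unfolding pm.subspace_def subset_iff mem_Collect_eq in_keys_iff lookup_add lookup_pm_scale
    by (auto, metis add.right_neutral)
next
  fix U :: "('a \<Rightarrow>\<^sub>0 'k) set"
  assume U: "basis_vec ` A \<subseteq> U" "pm.subspace U"
  show "{p. Poly_Mapping.keys p \<subseteq> A} \<subseteq> U"
  proof
    fix p :: "'a \<Rightarrow>\<^sub>0 'k" assume "p \<in> {p. Poly_Mapping.keys p \<subseteq> A}"
    then have "lin_ext pm_scale basis_vec p \<in> U"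
      unfolding lin_ext_def using U(1)
      by (intro pm.subspace_sum[OF U(2)] pm.subspace_scale[OF U(2)]) auto
    then show "p \<in> U"
      using lin_ext_unique[OF pm.linear_ident] by metis
  qed
qed

lemma inj_basis_vec: "inj (basis_vec :: 'a \<Rightarrow> 'a \<Rightarrow>\<^sub>0 'k::field)"
  by (rule injI) (metis basis_vec_def keys_single singleton_inject zero_neq_one)

lemma lookup_basis_vec: "Poly_Mapping.lookup (basis_vec y) x = (1 when y = x)"
  by (simp add: basis_vec_def lookup_single)

lemma independent_basis_vec: "pm.independent (basis_vec ` A :: ('a \<Rightarrow>\<^sub>0 'k::field) set)"
  unfolding pm.independent_explicit_module
proof (intro allI impI)
  fix T :: "('a \<Rightarrow>\<^sub>0 'k) set" and u v
  assume T: "finite T" "T \<subseteq> basis_vec ` A" "(\<Sum>v\<in>T. pm_scale (u v) v) = 0" "v \<in> T"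
  then obtain x where x: "v = basis_vec x" by auto
  have "u w * Poly_Mapping.lookup w x = (if w = v then u v else 0)" if "w \<in> T" for w
  proof -
    obtain y where "w = basis_vec y" using \<open>w \<in> T\<close> T(2) by auto
    then show ?thesis using x
      by (cases "y = x") (simp_all add: inj_eq[OF inj_basis_vec] lookup_basis_vec)
  qed
  then have "(\<Sum>w\<in>T. u w * Poly_Mapping.lookup w x) = u v"
    using T(1,4) by simp
  moreover have "(\<Sum>w\<in>T. u w * Poly_Mapping.lookup w x) = 0"
    using arg_cong[OF T(3), of "\<lambda>p. Poly_Mapping.lookup p x"] by (simp add: lookup_sum)
  ultimately show "u v = 0" by simp
qed

lemma free_op_eq_span: "free_op n = pm.span (basis_vec ` {t. leaves t = n})"
  by (auto simp: span_basis_vec free_op_def)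

lemma linear_span_subset:
  assumes "Vector_Spaces.linear s1 s2 f" "f ` S \<subseteq> T"
  shows "f ` module.span s1 S \<subseteq> module.span s2 T"
proof -
  interpret Vector_Spaces.linear s1 s2 f by fact
  show ?thesis using span_image[of S] vs2.span_mono[OF assms(2)] by simp
qed

lemma Psi_component: "Psi n ` bg_component n \<subseteq> M_component n"
proof -
  have "(\<lambda>p. Psi n (abs_bg p)) ` free_op n \<subseteq> M_component n"
    unfolding free_op_eq_span M_component_def
    by (rule linear_span_subset[OF linear_Psi_abs_bg]) (auto simp: Psi_basis_vec degree_word_forest)
  then show ?thesis by (auto simp: bg_component_def)
qed

lemma leaves_normal_word: "leaves (normal_word (Rep_bgforest F)) = bgforest_degree F"
  by (metis degree_word_forest normal_word_inverse)

lemma normal_rep_component: "normal_rep ` M_component n \<subseteq> free_op n"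
  unfolding free_op_eq_span M_component_def
  by (rule linear_span_subset[OF linear_normal_rep]) (auto simp: leaves_normal_word)

lemma normal_rep_Psi:
  assumes "p \<in> free_op n"
  shows "abs_bg (normal_rep (Psi n (abs_bg p))) = abs_bg p"
proof (rule linear_eq_on_basis[where p = p, OF _ linear_abs_bg])
  note comp = Vector_Spaces.linear_compose[unfolded o_def]
  show "Vector_Spaces.linear pm_scale bg_scale (\<lambda>p. abs_bg (normal_rep (Psi n (abs_bg p))))"
    by (rule comp[OF comp[OF linear_Psi_abs_bg linear_normal_rep] linear_abs_bg])
  fix t assume "t \<in> Poly_Mapping.keys p"
  then have "leaves t = n" using assms by (simp add: free_op_def)
  then show "abs_bg (normal_rep (Psi n (abs_bg (basis_vec t)))) = abs_bg (basis_vec t)"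
    by (simp add: Psi_basis_vec bg_cong_abs_bg[OF bg_cong_normal_word, symmetric])
qed

lemma Psi_normal_rep:
  assumes "m \<in> M_component n"
  shows "Psi n (abs_bg (normal_rep m)) = m"
proof (rule linear_eq_on_basis[where p = m, OF _ pm.linear_ident])
  note comp = Vector_Spaces.linear_compose[unfolded o_def]
  show "Vector_Spaces.linear pm_scale pm_scale (\<lambda>m. Psi n (abs_bg (normal_rep m)))"
    by (rule comp[OF linear_normal_rep linear_Psi_abs_bg])
  fix F assume "F \<in> Poly_Mapping.keys m"
  then have "bgforest_degree F = n"
    using assms by (auto simp: M_component_def span_basis_vec)
  then show "Psi n (abs_bg (normal_rep (basis_vec F))) = basis_vec F"
    by (simp add: Psi_basis_vec leaves_normal_word normal_word_inverse)
qed

text \<open>In degree 0, \<open>f_BT\<close> counts the empty forest, which is not in the basis of \<open>\<M>\<close>.\<close>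

lemma card_bgforests:
  assumes "n \<ge> 1"
  shows "card {F. bgforest_degree F = n} = f_BT n"
proof -
  have "bij_betw Rep_bgforest {F. bgforest_degree F = n} {F \<in> bg_forests. fdegree F = n}"
    unfolding bij_betw_def
  proof
    show "inj_on Rep_bgforest {F. bgforest_degree F = n}"
      by (simp add: inj_on_def Rep_bgforest_inject)
    have "F \<in> Rep_bgforest ` {F. bgforest_degree F = n}"
      if "F \<in> bg_forests" "fdegree F = n" for F
    proof -
      have "F \<in> bg_forests - {[]}" using that assms by auto
      then obtain G where "F = Rep_bgforest G" by (rule Rep_bgforest_cases)
      then show ?thesis using that by (auto simp: bgforest_degree.rep_eq)
    qed
    then show "Rep_bgforest ` {F. bgforest_degree F = n} = {F \<in> bg_forests. fdegree F = n}"
      using Rep_bgforest by (auto simp: bgforest_degree.rep_eq)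
  qed
  then show ?thesis unfolding f_BT_def by (rule bij_betw_same_card)
qed

theorem corollary34:
  fixes n :: nat
  assumes "n \<ge> 1"
  shows "bg.dim (bg_component n :: 'k::field bg set) = f_BT n \<and>
    bij_betw (Psi n :: 'k bg \<Rightarrow> (bgforest \<Rightarrow>\<^sub>0 'k)) (bg_component n) (M_component n)"
proof
  define \<theta> :: "(bgforest \<Rightarrow>\<^sub>0 'k) \<Rightarrow> 'k bg" where "\<theta> m = abs_bg (normal_rep m)" for m
  have \<theta>_Psi: "\<theta> (Psi n p) = p" if "p \<in> bg_component n" for p
    using that normal_rep_Psi by (auto simp: bg_component_def \<theta>_def)
  have Psi_\<theta>: "Psi n (\<theta> m) = m" if "m \<in> M_component n" for m
    using that by (simp add: \<theta>_def Psi_normal_rep)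
  have \<theta>_comp: "\<theta> ` M_component n \<subseteq> bg_component n"
    using normal_rep_component by (fastforce simp: \<theta>_def bg_component_def)
  show "bij_betw (Psi n :: 'k bg \<Rightarrow> (bgforest \<Rightarrow>\<^sub>0 'k)) (bg_component n) (M_component n)"
    by (rule bij_betw_byWitness[where f' = \<theta>])
      (simp_all add: \<theta>_Psi Psi_\<theta> \<theta>_comp Psi_component)
  let ?E = "basis_vec ` {F. bgforest_degree F = n} :: (bgforest \<Rightarrow>\<^sub>0 'k) set"
  have "Vector_Spaces.linear pm_scale bg_scale \<theta>"
    unfolding \<theta>_def
    by (rule Vector_Spaces.linear_compose[OF linear_normal_rep linear_abs_bg, unfolded o_def])
  then interpret \<theta>: Vector_Spaces.linear pm_scale bg_scale \<theta> .
  \<comment> \<open>Linear independence is visible in \<open>\<M>\<close> and not in the quotient, so the basis is carried over by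
    the inverse of \<open>\<Psi>\<close>.\<close>
  have inj: "inj_on \<theta> (pm.span ?E)"
    using Psi_\<theta> unfolding M_component_def by (rule inj_on_inverseI)
  have "bg_component n = \<theta> ` M_component n"
    using \<theta>_comp \<theta>_Psi Psi_component[of n] by force
  also have "\<dots> = bg.span (\<theta> ` ?E)"
    by (simp add: M_component_def \<theta>.span_image)
  finally have "bg.dim (bg_component n :: 'k bg set) = card (\<theta> ` ?E)"
    using \<theta>.independent_injective_image[OF independent_basis_vec inj]
    by (simp add: bg.dim_eq_card_independent)
  also have "\<dots> = card ?E"
    using inj pm.span_superset by (intro card_image) (rule inj_on_subset)
  also have "\<dots> = f_BT n"
    by (simp add: card_image inj_on_subset[OF inj_basis_vec] card_bgforests[OF assms])
  finally show "bg.dim (bg_component n :: 'k bg set) = f_BT n" .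
qed

end
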